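(* Under the resilience bound $n\ge 3f+1$ (with $n=\mathcal{O}(f)$), for the two cryptographic protocols of the context and under the delay model of the context, the probability of a (causal-ordering) strong safety violation at any correct process $p_j$, over all causal path lengths $\ge 2$ (causal chains through distinct, correct or Byzantine, processes), is $$\mathcal{O}\!\left(\frac{\ln^2 f}{f}\right).$$
   Context: System and protocols: $n$ asynchronous processes, at most $f$ of them Byzantine, reliable authenticated FIFO channels. A causal layer (BCRB) runs on top of Bracha's Byzantine Reliable Broadcast (BRB: the sender sends INIT; on INIT a process sends ECHO to all; on $(n+f)/2$ ECHOs or $f+1$ READYs it sends READY to all; on $2f+1$ READYs it BRB-delivers). Payloads are encrypted with an $(n-f,n)$ threshold scheme. On BRB-delivering an application message $m$ (processed in sender-FIFO order), a correct process issues an acknowledgment ACK$(m)$ carrying a decryption share and a hash of the ciphertext. In the first protocol the ACK is sent point-to-point to all and carries the sequence number of the process's own next broadcast; a receiver that has BRB-delivered $m$ adds to its local dependency graph an edge from that next message to $m$ if that next message is not yet BCRB-delivered locally (if that next message is already BRB-delivered locally, only if its local BRB-delivery timestamp is later than that of $m$). In the second protocol the ACK is itself sent by BRB, with its own sequence number $sn$ in the sender's sequence, and a receiver adds an edge from the sender's message number $sn+1$ to $m$. An application message is BCRB-delivered once its sender-FIFO predecessors have been processed for delivery, $n-f$ shares for it have been collected, and it has no outgoing edge in the local dependency graph; it is then removed from the graph with its incident edges. (In the second protocol, ACKs are processed under the same FIFO and no-outgoing-edge conditions, without the share condition.) A Byzantine process may omit sending ACKs. Happens-before: $m\to m'$ if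 some process BCRB-broadcasts or BCRB-delivers $m$ before BCRB-broadcasting $m'$, closed under transitivity. Strong (causal) safety: if $m\to m'$, then no correct process BCRB-delivers $m'$ before $m$. Path length 2 means: $p_i$ broadcasts $m_1$, $p_k$ broadcasts $m_2$ after delivering $m_1$, and the delivery order of $m_1,m_2$ is considered at $p_j$; a path of length $L$ corresponds to a causal chain $m_1\to m_2\to\dots\to m_L$, the order of $m_1,m_L$ being considered at $p_j$. Delay model: link delays are independent exponential random variables with rate $\lambda$, and each protocol phase is assumed (as an approximation) to end at all correct processes at the same time, so that the sequential phases are independent. Let $M_K$ denote the distribution of the maximum of $K$ independent $\mathrm{Exp}(\lambda)$ variables. Time is measured from the moment at which $f+1$ correct processes have sent READY for $m_1$. - Worst-case time of BCRB-delivery of $m_1$ at $p_j$: $A=T_1^{(1)}+T_2^{(1)}+T_3^{(1)}$, with $T_1^{(1)},T_2^{(1)}\sim M_{f+1}$ (READY phases for $m_1$) and $T_3^{(1)}\sim M_{2f+1}$ (ACK phase). - Best-case time of BCRB-delivery of $m_2$ at $p_j$ (path length 2): $B=T_1^{(2)}+T_2^{(2)}+Y+T_3^{(2)}+T_4^{(2)}+T_5^{(2)}$, with $T_1^{(2)}\sim M_{f+1}$ (READY phase for $m_1$, of the same duration as $T_1^{(1)}$), $T_2^{(2)}\sim M_{f+1}$ (ACKs for $m_1$), $Y\sim\mathrm{Exp}(\lambda)$ (INIT of $m_2$), $T_3^{(2)}\sim M_{2f+1}$ (ECHO), $T_4^{(2)}\sim M_{f+1}$ (READY), $T_5^{(2)}\sim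 M_{f+1}$ (ACK). - For a path of length $L>2$: $B(L)=T_1^{(2)}+T_2^{(2)}+L\,(Y+T_3^{(2)}+T_4^{(2)}+T_5^{(2)})$. Since processes on the path may omit their ACKs, a strong safety violation at $p_j$ along a path is the event $B<A$ (respectively $B(L)<A$). *)

theory Defs
  imports "HOL-Probability.Probability" "HOL-Library.Landau_Symbols"
begin

text \<open>The law \<open>M_K\<close> of the maximum of \<open>K\<close> independent \<open>Exp(l)\<close> variables (used for \<open>K > 0\<close>).\<close>

definition max_exponential :: "real \<Rightarrow> nat \<Rightarrow> real measure" where
  "max_exponential l K =
     distr (Pi\<^sub>M {..<K} (\<lambda>_. density lborel (\<lambda>x. ennreal (exponential_density l x)))) borel
       (\<lambda>x. Max (x ` {..<K}))"

text \<open>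
  The sequential phases.  The first three make up the worst-case BCRB-delivery of \<open>m\<^sub>1\<close>
  (\<open>T\<^sub>1\<close>, \<open>T\<^sub>2\<close>, \<open>T\<^sub>3\<close> with superscript (1)).  The remaining ones belong to the best-case
  BCRB-delivery of the last message of a causal path, and carry the path length: for length
  \<open>L\<close> they are \<open>T\<^sub>2\<close>, \<open>Y\<close>, \<open>T\<^sub>3\<close>, \<open>T\<^sub>4\<close>, \<open>T\<^sub>5\<close> with superscript (2), in this order.
  Being best cases, they depend on the path only through its length.
  The phase \<open>T\<^sub>1\<close> with superscript (2) has the same duration as \<open>T\<^sub>1\<close> with superscript (1),
  so both are the single phase \<open>Ready_m1\<close>.
\<close>

datatype phase =
    Ready_m1
  | Ready'_m1
  | Ack_m1_worst
  | Ack_m1 nat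
  | Init nat
  | Echo nat
  | Ready nat
  | Ack nat

fun phase_law :: "real \<Rightarrow> nat \<Rightarrow> phase \<Rightarrow> real measure" where
  "phase_law l f Ready_m1 = max_exponential l (f + 1)"
| "phase_law l f Ready'_m1 = max_exponential l (f + 1)"
| "phase_law l f Ack_m1_worst = max_exponential l (2 * f + 1)"
| "phase_law l f (Ack_m1 L) = max_exponential l (f + 1)"
| "phase_law l f (Init L) = density lborel (\<lambda>x. ennreal (exponential_density l x))"
| "phase_law l f (Echo L) = max_exponential l (2 * f + 1)"
| "phase_law l f (Ready L) = max_exponential l (f + 1)"
| "phase_law l f (Ack L) = max_exponential l (f + 1)"

definition path_phases :: "nat \<Rightarrow> phase set" where
  "path_phases L =
     {Ready_m1, Ready'_m1, Ack_m1_worst, Ack_m1 L, Init L, Echo L, Ready L, Ack L}"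

text \<open>
  The delay model for \<open>n\<close> processes \<open>{..<n}\<close>, the set \<open>Byz\<close> of which is Byzantine.
  \<open>D ph p\<close> is the duration of phase \<open>ph\<close> as experienced by process \<open>p\<close>; \<open>simultaneous\<close> is
  the approximation that a phase ends at all correct processes at the same time.
  Nothing is assumed on the joint law of the phases of paths of different lengths, except
  that they all refer to the same \<open>m\<^sub>1\<close>.
\<close>

locale delay_model = prob_space M
  for M :: "'a measure" +
  fixes n f :: nat and Byz :: "nat set" and l :: real
    and D :: "phase \<Rightarrow> nat \<Rightarrow> 'a \<Rightarrow> real"
  assumes Byz_subset: "Byz \<subseteq> {..<n}"
    and card_Byz: "card Byz \<le> f"
    and simultaneous:
      "\<And>ph p q. p \<in> {..<n} - Byz \<Longrightarrow> q \<in> {..<n} - Byz \<Longrightarrow> D ph p = D ph q"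
    and law:
      "\<And>L ph p. 2 \<le> L \<Longrightarrow> L \<le> n \<Longrightarrow> ph \<in> path_phases L \<Longrightarrow> p \<in> {..<n} - Byz \<Longrightarrow>
         distr M borel (D ph p) = phase_law l f ph"
    and indep:
      "\<And>L p. 2 \<le> L \<Longrightarrow> L \<le> n \<Longrightarrow> p \<in> {..<n} - Byz \<Longrightarrow>
         indep_vars (\<lambda>_. borel) (\<lambda>ph. D ph p) (path_phases L)"

text \<open>\<open>A\<close>: worst-case time of BCRB-delivery of \<open>m\<^sub>1\<close> at process \<open>p\<close>.\<close>

definition delivery_first :: "(phase \<Rightarrow> nat \<Rightarrow> 'a \<Rightarrow> real) \<Rightarrow> nat \<Rightarrow> 'a \<Rightarrow> real" where
  "delivery_first D p \<omega> = D Ready_m1 p \<omega> + D Ready'_m1 p \<omega> + D Ack_m1_worst p \<omega>"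

text \<open>
  \<open>B\<close> for \<open>L = 2\<close> and \<open>B(L)\<close> for \<open>L > 2\<close>: best-case time of BCRB-delivery at \<open>p\<close> of the last
  message of a causal path of length \<open>L\<close>.  The block of four phases is counted once for
  \<open>L = 2\<close> but \<open>L\<close> times for \<open>L > 2\<close>.
\<close>

definition delivery_last :: "(phase \<Rightarrow> nat \<Rightarrow> 'a \<Rightarrow> real) \<Rightarrow> nat \<Rightarrow> nat \<Rightarrow> 'a \<Rightarrow> real" where
  "delivery_last D L p \<omega> =
     D Ready_m1 p \<omega> + D (Ack_m1 L) p \<omega> +
     (if L = 2 then 1 else real L) *
       (D (Init L) p \<omega> + D (Echo L) p \<omega> + D (Ready L) p \<omega> + D (Ack L) p \<omega>)"

text \<open>
  A causal path of length \<open>L\<close> from \<open>i\<close> is the list of the senders of a causal chain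
  \<open>m\<^sub>1 \<rightarrow> \<dots> \<rightarrow> m\<^sub>L\<close> with \<open>m\<^sub>1\<close> sent by \<open>i\<close>: distinct processes, correct or Byzantine.
\<close>

definition causal_paths :: "nat \<Rightarrow> nat \<Rightarrow> nat list set" where
  "causal_paths n i = {c. 2 \<le> length c \<and> hd c = i \<and> distinct c \<and> set c \<subseteq> {..<n}}"

text \<open>At \<open>p\<close>, the last message of the path \<open>c\<close> is BCRB-delivered before the first one.\<close>

definition strong_safety_violation ::
  "(phase \<Rightarrow> nat \<Rightarrow> 'a \<Rightarrow> real) \<Rightarrow> nat list \<Rightarrow> nat \<Rightarrow> 'a \<Rightarrow> bool" where
  "strong_safety_violation D c p \<omega> \<longleftrightarrow>
     delivery_last D (length c) p \<omega> < delivery_first D p \<omega>"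

end

theory Submission
  imports Defs "HOL-Real_Asymp.Real_Asymp"
begin

text \<open>
  The phase \<open>Ready_m1\<close> cancels, so a violation means that the two remaining phases of \<open>m\<^sub>1\<close>
  outlast at least four maxima and one nonnegative delay.  Let \<open>g\<close> be the time with
  \<open>exp (- l * g) = 2 * ln f / f\<close>.  If each of the four maxima exceeds \<open>g\<close>, then one of the two
  phases of \<open>m\<^sub>1\<close> exceeds \<open>2 * g\<close>, which has probability of order
  \<open>f * exp (- 2 * l * g)\<close>, that is, of order \<open>ln\<^sup>2 f / f\<close>.  A maximum of \<open>K \<ge> f\<close> exponentials is
  at most \<open>g\<close> with probability at most \<open>exp (- K * exp (- l * g)) \<le> 1 / f\<^sup>2\<close>, and a union bound
  over the \<open>O(f)\<close> path lengths costs \<open>O(1 / f)\<close>.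
\<close>

text \<open>A maximum is at most \<open>a\<close> iff every coordinate is, so the event is a box and
  its product measure factorises. Positivity of \<open>K\<close> keeps the argument of
  \<open>Max\<close> nonempty.\<close>

lemma max_exponential_atMost:
  assumes l: "0 < l" and K: "0 < K" and a: "0 \<le> a"
  shows "measure (max_exponential l K) {..a} = (1 - exp (- l * a)) ^ K"
proof -
  let ?E = "density lborel (\<lambda>x. ennreal (exponential_density l x))"
  interpret E: prob_space ?E
    using l by (rule prob_space_exponential_density)
  interpret P: product_sigma_finite "\<lambda>_::nat. ?E"
    by standard
  let ?P = "Pi\<^sub>M {..<K} (\<lambda>_. ?E)"
  have [measurable]: "(\<lambda>x. Max (x ` {..<K})) \<in> borel_measurable ?P"
    by (intro borel_measurable_Max) auto
  have "emeasure (max_exponential l K) {..a}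
      = emeasure ?P ((\<lambda>x. Max (x ` {..<K})) -` {..a} \<inter> space ?P)"
    unfolding max_exponential_def by (intro emeasure_distr) auto
  also have "(\<lambda>x. Max (x ` {..<K})) -` {..a} \<inter> space ?P = Pi\<^sub>E {..<K} (\<lambda>_. {..a})"
    using K by (auto simp: space_PiM PiE_def Pi_def Max_le_iff lessThan_empty_iff)
  also have "emeasure ?P \<dots> = (\<Prod>i<K. emeasure ?E {..a})"
    by (intro P.emeasure_PiM) auto
  \<comment> \<open>\<open>exponential_density\<close> is the Erlang density of shape 0, so the
    Erlang CDF applies.\<close>
  also have "\<dots> = ennreal ((1 - exp (- l * a)) ^ K)"
    using l a by (simp add: emeasure_erlang_density erlang_CDF_def ennreal_power)
  finally show ?thesis
    using l a by (simp add: measure_def)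
qed

text \<open>From \<open>1 - x \<le> exp (- x)\<close>, raised to the power \<open>K\<close>. The
  smaller \<open>K'\<close> lets one bound cover both phase sizes, \<open>f + 1\<close> and
  \<open>2 * f + 1\<close>.\<close>

lemma max_exponential_atMost_le:
  assumes l: "0 < l" and "0 < K'" "K' \<le> K" and a: "0 \<le> a"
  shows "measure (max_exponential l K) {..a} \<le> exp (- (real K' * exp (- l * a)))"
proof -
  have "measure (max_exponential l K) {..a} = (1 - exp (- l * a)) ^ K"
    using assms by (intro max_exponential_atMost) auto
  also have "\<dots> \<le> exp (- exp (- l * a)) ^ K"
    using l a exp_ge_add_one_self[of "- exp (- l * a)"] by (intro power_mono) auto
  also have "\<dots> = exp (- (real K * exp (- l * a)))"
    by (simp flip: exp_of_nat_mult)
  also have "\<dots> \<le> exp (- (real K' * exp (- l * a)))"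
    using assms by simp
  finally show ?thesis .
qed

lemma prob_space_max_exponential:
  assumes l: "0 < l"
  shows "prob_space (max_exponential l K)"
proof -
  let ?E = "density lborel (\<lambda>x. ennreal (exponential_density l x))"
  interpret E: prob_space ?E
    using l by (rule prob_space_exponential_density)
  interpret P: product_prob_space "\<lambda>_::nat. ?E" "{..<K}"
    by standard
  show ?thesis
    unfolding max_exponential_def
    by (intro P.prob_space_distr borel_measurable_Max) auto
qed

text \<open>This is the union bound over the \<open>K\<close> coordinates, obtained from the exact
  CDF by Bernoulli's inequality.\<close>

lemma max_exponential_greaterThan_le:
  assumes l: "0 < l" and K: "0 < K" and a: "0 \<le> a"
  shows "measure (max_exponential l K) {a<..} \<le> real K * exp (- l * a)"
proof -
  interpret prob_space "max_exponential l K"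
    using l by (rule prob_space_max_exponential)
  have sets: "sets (max_exponential l K) = sets borel" "space (max_exponential l K) = UNIV"
    by (simp_all add: max_exponential_def)
  have "{a<..} = space (max_exponential l K) - {..a}"
    by (auto simp: sets)
  also have "measure (max_exponential l K) \<dots> = 1 - (1 - exp (- l * a)) ^ K"
    using max_exponential_atMost[OF assms] by (subst prob_compl) (auto simp: sets)
  also have "\<dots> \<le> real K * exp (- l * a)"
    using Bernoulli_inequality[of "- exp (- l * a)" K] l a by simp
  finally show ?thesis .
qed

context delay_model
begin

lemma exists_correct:
  assumes "3 * f + 1 \<le> n"
  obtains p where "p \<in> {..<n} - Byz"
proof -
  have "card Byz < card {..<n}"
    using card_Byz assms by simp
  then show ?thesis
    using that card_mono[of Byz "{..<n}"] finite_subset[OF Byz_subset]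
    by (meson Diff_eq_empty_iff equals0I finite_lessThan leD)
qed

lemma phase_measurable:
  assumes "2 \<le> L" "L \<le> n" "p \<in> {..<n} - Byz" "ph \<in> path_phases L"
  shows "random_variable borel (D ph p)"
  using indep[OF assms(1-3)] assms(4) by (auto simp: indep_vars_def)

lemma prob_phase:
  assumes "2 \<le> L" "L \<le> n" "p \<in> {..<n} - Byz" "ph \<in> path_phases L" "S \<in> sets borel"
  shows "prob {\<omega> \<in> space M. D ph p \<omega> \<in> S} = measure (phase_law l f ph) S"
    and "{\<omega> \<in> space M. D ph p \<omega> \<in> S} \<in> events"
proof -
  note [measurable] = phase_measurable[OF assms(1-4)] assms(5)
  have "measure (phase_law l f ph) S = measure (distr M borel (D ph p)) S"
    using law[OF assms(1,2,4,3)] by simp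
  also have "\<dots> = prob {\<omega> \<in> space M. D ph p \<omega> \<in> S}"
    using assms(5) by (subst measure_distr) (auto intro!: arg_cong[where f=prob])
  finally show "prob {\<omega> \<in> space M. D ph p \<omega> \<in> S} = measure (phase_law l f ph) S" ..
  show "{\<omega> \<in> space M. D ph p \<omega> \<in> S} \<in> events"
    by measurable
qed

text \<open>A violation depends on the path only through its length, so the union bound runs over
  lengths and costs a factor \<open>n\<close>, whatever the joint law across lengths. The threshold
  \<open>g\<close> stays free and is optimised later.\<close>

lemma prob_violation_le:
  assumes l: "0 < l" and n: "3 * f + 1 \<le> n" and f: "0 < f" and g: "0 \<le> g"
  shows "prob {\<omega> \<in> space M. \<exists>p \<in> {..<n} - Byz. \<exists>c \<in> causal_paths n i.
            strong_safety_violation D c p \<omega>}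
         \<le> real (3 * f + 2) * exp (- l * (2 * g))
            + 4 * real n * exp (- (real (f + 1) * exp (- l * g)))"
    (is "prob ?V \<le> _")
proof -
  \<comment> \<open>By \<open>simultaneous\<close>, this one correct process stands for all of them,
    so the quantifier over processes costs no factor.\<close>
  obtain p where p: "p \<in> {..<n} - Byz"
    using exists_correct[OF n] .
  define ev where "ev ph S = {\<omega> \<in> space M. D ph p \<omega> \<in> S}" for ph S
  \<comment> \<open>The phases in \<open>U1\<close> are shared by all lengths, so its probability is
    counted once. Only \<open>U2 L\<close> is summed over \<open>L\<close>.\<close>
  define U1 where "U1 = ev Ready'_m1 {2 * g<..} \<union> ev Ack_m1_worst {2 * g<..}"
  define U2 where "U2 L = ev (Init L) {..0} \<union> ev (Ack_m1 L) {..g} \<union> ev (Echo L) {..g}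
      \<union> ev (Ready L) {..g} \<union> ev (Ack L) {..g}" for L
  let ?q = "exp (- (real (f + 1) * exp (- l * g)))"
  have n2: "2 \<le> n" using n f by simp
  have P1: "Ready'_m1 \<in> path_phases 2" "Ack_m1_worst \<in> path_phases 2"
    by (auto simp: path_phases_def)
  have P2: "Ack_m1 L \<in> path_phases L" "Init L \<in> path_phases L" "Echo L \<in> path_phases L"
      "Ready L \<in> path_phases L" "Ack L \<in> path_phases L" for L
    by (auto simp: path_phases_def)
  \<comment> \<open>Laws are given per path length; the phases in \<open>U1\<close> belong to every
    \<open>path_phases L\<close>, so length 2 serves.\<close>
  note ev1 = prob_phase[OF order_refl n2 p, folded ev_def]
  have U1_ev [simp]: "U1 \<in> events"
    unfolding U1_def using P1 by (intro sets.Un ev1) auto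
  have "prob U1 \<le> prob (ev Ready'_m1 {2 * g<..}) + prob (ev Ack_m1_worst {2 * g<..})"
    unfolding U1_def using P1 by (intro measure_Un_le ev1) auto
  also have "\<dots> \<le> real (f + 1) * exp (- l * (2 * g)) + real (2 * f + 1) * exp (- l * (2 * g))"
    unfolding ev1(1)[OF P1(1) greaterThan_borel] ev1(1)[OF P1(2) greaterThan_borel] phase_law.simps
    using l g by (intro add_mono max_exponential_greaterThan_le) auto
  also have "\<dots> = real (3 * f + 2) * exp (- l * (2 * g))"
    by (simp add: algebra_simps)
  finally have U1: "prob U1 \<le> real (3 * f + 2) * exp (- l * (2 * g))" .
  have U2_ev: "U2 L \<in> events" and U2: "prob (U2 L) \<le> 4 * ?q" if L: "L \<in> {2..n}" for L
  proof -
    have L': "2 \<le> L" "L \<le> n" using L by auto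
    note ev2 = prob_phase[OF L' p, folded ev_def]
    show "U2 L \<in> events"
      unfolding U2_def using P2 by (intro sets.Un ev2) auto
    \<comment> \<open>Delays are nonnegative only almost surely; this null event makes
      \<open>Init L\<close> strictly positive outside \<open>U2 L\<close>.\<close>
    have init: "prob (ev (Init L) {..0}) = 0"
      unfolding ev2(1)[OF P2(2) atMost_borel] using l
      by (simp add: measure_def emeasure_erlang_density erlang_CDF_at0)
    have low: "prob (ev ph {..g}) \<le> ?q" if "ph \<in> {Ack_m1 L, Echo L, Ready L, Ack L}" for ph
    proof -
      have "ph \<in> path_phases L"
        using that P2 by auto
      then have "prob (ev ph {..g}) = measure (phase_law l f ph) {..g}"
        by (rule ev2) auto
      also have "\<dots> \<le> ?q"
        using that max_exponential_atMost_le[OF l _ _ g, of "f + 1"] by auto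
      finally show ?thesis .
    qed
    have "prob (U2 L) \<le> prob (ev (Init L) {..0}) + prob (ev (Ack_m1 L) {..g})
        + prob (ev (Echo L) {..g}) + prob (ev (Ready L) {..g}) + prob (ev (Ack L) {..g})"
      unfolding U2_def using P2
      by (intro order_trans[OF measure_Un_le] add_mono order_refl sets.Un ev2(2)) auto
    also have "\<dots> \<le> 0 + ?q + ?q + ?q + ?q"
      using init by (intro add_mono low) auto
    finally show "prob (U2 L) \<le> 4 * ?q" by simp
  qed
  have "?V \<subseteq> U1 \<union> (\<Union>L\<in>{2..n}. U2 L)"
  proof
    fix \<omega> assume "\<omega> \<in> ?V"
    then obtain p' c where \<omega>: "\<omega> \<in> space M" and p': "p' \<in> {..<n} - Byz"
      and c: "c \<in> causal_paths n i" and viol: "strong_safety_violation D c p' \<omega>"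
      by auto
    define L where "L = length c"
    \<comment> \<open>The senders are distinct, which caps the path length at
      \<open>n\<close>.\<close>
    have "length c = card (set c)"
      using c by (simp add: causal_paths_def distinct_card)
    also have "\<dots> \<le> card {..<n}"
      using c by (intro card_mono) (auto simp: causal_paths_def)
    finally have L: "L \<in> {2..n}"
      using c by (simp add: causal_paths_def L_def)
    define k where "k = (if L = 2 then 1 else real L)"
    have k: "1 \<le> k" using L by (auto simp: k_def)
    have same: "D ph p' = D ph p" for ph
      using simultaneous p p' by blast
    have less: "D (Ack_m1 L) p \<omega> + k * (D (Init L) p \<omega> + D (Echo L) p \<omega> + D (Ready L) p \<omega> + D (Ack L) p \<omega>)
        < D Ready'_m1 p \<omega> + D Ack_m1_worst p \<omega>"
      using viol unfolding strong_safety_violation_def delivery_last_def delivery_first_def same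
        k_def L_def by linarith
    show "\<omega> \<in> U1 \<union> (\<Union>L\<in>{2..n}. U2 L)"
    proof (rule ccontr)
      assume "\<omega> \<notin> U1 \<union> (\<Union>L\<in>{2..n}. U2 L)"
      then have "\<omega> \<notin> U1" "\<omega> \<notin> U2 L"
        using L by auto
      then have up: "D Ready'_m1 p \<omega> \<le> 2 * g" "D Ack_m1_worst p \<omega> \<le> 2 * g"
        and low: "0 < D (Init L) p \<omega>" "g < D (Ack_m1 L) p \<omega>" "g < D (Echo L) p \<omega>"
          "g < D (Ready L) p \<omega>" "g < D (Ack L) p \<omega>"
        using \<omega> by (auto simp: U1_def U2_def ev_def)
      define s where "s = D (Init L) p \<omega> + D (Echo L) p \<omega> + D (Ready L) p \<omega> + D (Ack L) p \<omega>"
      have s: "3 * g < s"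
        using low by (simp add: s_def)
      \<comment> \<open>As \<open>s\<close> is positive, the multiplicity \<open>k\<close> can be
        lowered to 1. The last message then takes more than \<open>4 * g\<close>, the first at most
        \<open>4 * g\<close>, apart from the common phase.\<close>
      then have "1 * s \<le> k * s"
        using k g by (intro mult_right_mono) auto
      then show False
        using less up low(2) s unfolding s_def[symmetric] by linarith
    qed
  qed
  then have "prob ?V \<le> prob (U1 \<union> (\<Union>L\<in>{2..n}. U2 L))"
    using U2_ev by (intro finite_measure_mono) auto
  also have "\<dots> \<le> prob U1 + prob (\<Union>L\<in>{2..n}. U2 L)"
    using U2_ev by (intro measure_Un_le) auto
  also have "prob (\<Union>L\<in>{2..n}. U2 L) \<le> (\<Sum>L\<in>{2..n}. prob (U2 L))"
    using U2_ev by (intro finite_measure_subadditive_finite) auto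
  also have "\<dots> \<le> (\<Sum>L\<in>{2..n}. 4 * ?q)"
    using U2 by (intro sum_mono)
  also have "\<dots> = real (n - 1) * (4 * ?q)"
    using n2 by (simp add: Suc_diff_le)
  also have "\<dots> \<le> real n * (4 * ?q)"
    by (intro mult_right_mono) auto
  finally show ?thesis
    using U1 by (simp add: algebra_simps)
qed

end

theorem corollary5p11:
  fixes l :: real
    and n i :: "nat \<Rightarrow> nat"
    and Byz :: "nat \<Rightarrow> nat set"
    and M :: "nat \<Rightarrow> 'a measure"
    and D :: "nat \<Rightarrow> phase \<Rightarrow> nat \<Rightarrow> 'a \<Rightarrow> real"
  assumes rate: "0 < l"
    and resilience: "\<And>f. 3 * f + 1 \<le> n f"
    and linear: "(\<lambda>f. real (n f)) \<in> O(\<lambda>f. real f)"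
    and sender: "\<And>f. i f < n f"
    and model: "\<And>f. delay_model (M f) (n f) f (Byz f) l (D f)"
  shows "(\<lambda>f. measure (M f)
            {\<omega> \<in> space (M f). \<exists>p \<in> {..<n f} - Byz f. \<exists>c \<in> causal_paths (n f) (i f).
               strong_safety_violation (D f) c p \<omega>})
         \<in> O(\<lambda>f. (ln (real f))\<^sup>2 / real f)"
    (is "?P \<in> _")
proof -
  obtain C where C: "0 < C" and n: "eventually (\<lambda>f. norm (real (n f)) \<le> C * norm (real f)) at_top"
    using linear by (elim landau_o.bigE)
  \<comment> \<open>This bound gives \<open>0 \<le> g\<close>. The next one makes
    \<open>ln (2 * ?x)\<close> meaningful and finally absorbs the \<open>1 / f\<close> term into
    \<open>(ln f)^2 / f\<close>.\<close>
  have "eventually (\<lambda>f::nat. 2 * ln (real f) \<le> real f) at_top"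
    by real_asymp
  moreover have "eventually (\<lambda>f::nat. 1 \<le> ln (real f)) at_top"
    by real_asymp
  ultimately have "eventually (\<lambda>f. norm (?P f) \<le> (20 + 4 * C) * norm ((ln (real f))\<^sup>2 / real f)) at_top"
    using n eventually_gt_at_top[of 0]
  proof eventually_elim
    case (elim f)
    interpret delay_model "M f" "n f" f "Byz f" l "D f"
      by (rule model)
    let ?x = "ln (real f)"
    \<comment> \<open>The factor 2 makes each lower tail at most \<open>1 / f^2\<close>, which beats
      the \<open>O(f)\<close> path lengths; a factor 1 would bound their total only by a
      constant.\<close>
    define g where "g = (?x - ln (2 * ?x)) / l"
    have f: "1 \<le> real f" using elim by simp
    have x: "0 < 2 * ?x" using elim by simp
    have "ln (2 * ?x) \<le> ?x"
      using elim x by (subst ln_le_cancel_iff) auto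
    then have g: "0 \<le> g"
      using rate by (simp add: g_def)
    have "- l * g = ln (2 * ?x) - ?x"
      using rate by (simp add: g_def)
    then have exp_g: "exp (- l * g) = 2 * ?x / real f"
      using x f by (simp add: exp_diff)
    have "exp (- l * (2 * g)) = (exp (- l * g))\<^sup>2"
      by (simp flip: exp_double)
    then have exp_2g: "exp (- l * (2 * g)) = 4 * ?x\<^sup>2 / (real f)\<^sup>2"
      unfolding exp_g by (simp add: power_divide power_mult_distrib)
    have "2 * ?x \<le> real (f + 1) * exp (- l * g)"
      unfolding exp_g using x f by (simp add: field_simps)
    then have "exp (- (real (f + 1) * exp (- l * g))) \<le> exp (- (2 * ?x))"
      by simp
    also have "\<dots> = 1 / (real f)\<^sup>2"
      using f by (simp add: exp_minus exp_double inverse_eq_divide)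
    finally have q: "exp (- (real (f + 1) * exp (- l * g))) \<le> 1 / (real f)\<^sup>2" .
    have "?P f \<le> real (3 * f + 2) * exp (- l * (2 * g))
        + 4 * real (n f) * exp (- (real (f + 1) * exp (- l * g)))"
      using rate resilience elim g by (intro prob_violation_le) auto
    \<comment> \<open>Uses \<open>3 * f + 2 \<le> 5 * f\<close> for \<open>f \<ge> 1\<close>, and
      \<open>C\<close> from the linear growth of \<open>n\<close>.\<close>
    also have "\<dots> \<le> (5 * real f) * (4 * ?x\<^sup>2 / (real f)\<^sup>2) + 4 * (C * real f) * (1 / (real f)\<^sup>2)"
      unfolding exp_2g using q f elim C by (intro add_mono mult_mono) auto
    also have "\<dots> = 20 * ?x\<^sup>2 / real f + 4 * C * 1 / real f"
      using f by (simp add: power2_eq_square field_simps)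
    also have "\<dots> \<le> 20 * ?x\<^sup>2 / real f + 4 * C * ?x\<^sup>2 / real f"
      using elim C f by (intro add_mono divide_right_mono mult_left_mono) (auto simp: one_le_power)
    also have "\<dots> = (20 + 4 * C) * (?x\<^sup>2 / real f)"
      by (simp add: algebra_simps add_divide_distrib)
    finally show ?case
      by simp
  qed
  then show ?thesis
    by (rule landau_o.bigI[rotated]) (use C in simp)
qed

end
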